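(* Let $S$ be a Hausdorff countably compact topological semigroup. Then the following conditions hold: (i) each maximal subgroup $H(e)$, $e\in E(S)$, is sequentially closed in $S$; (ii) the subset $H(S)$ is sequentially closed in $S$; (iii) the inversion $\operatorname{inv}\colon H(S)\to H(S)$ is sequentially continuous; (iv) the projection $\pi\colon H(S)\to E(S)$ is sequentially continuous.
   Context: A topological semigroup is a topological space with a continuous associative binary operation. A space $X$ is countably compact if every countable open cover of $X$ has a finite subcover. A subset $F$ of a space $X$ is sequentially closed if no sequence in $F$ converges to a point not in $F$. A map $f\colon X\to Y$ between topological spaces is sequentially continuous if $\lim_{n\to\infty} f(x_n)=f(\lim_{n\to\infty}x_n)$ for any convergent sequence $\{x_n\}_{n=1}^\infty$ in $X$. $E(S)$ denotes the set of idempotents of a semigroup $S$; for $e\in E(S)$, $H(e)$ is the maximal subgroup of $S$ with identity $e$; $H(S)=\bigcup_{e\in E(S)}H(e)$. The inversion $\operatorname{inv}\colon H(S)\to H(S)$ sends $x\in H(e)$ to its inverse $x^{-1}$ in the group $H(e)$, and the projection $\pi\colon H(S)\to E(S)$ is $\pi(x)=xx^{-1}$. Here $H(S)$ and $E(S)$ carry the subspace topologies from $S$. *)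

theory Defs
  imports "HOL-Analysis.Analysis" "HOL-Algebra.Group"
begin

definition idempotents :: "'a::semigroup_mult set" where
  "idempotents = {e. e * e = e}"

definition sub_structure :: "'a::semigroup_mult set \<Rightarrow> 'a \<Rightarrow> 'a monoid" where
  "sub_structure G e = \<lparr>carrier = G, monoid.mult = (*), one = e\<rparr>"

text \<open>The union of all subgroups with identity \<open>e\<close>; by \<open>group_maximal_subgroup\<close> below it is
  itself such a subgroup when \<open>e\<close> is idempotent, hence the largest one.\<close>

definition maximal_subgroup :: "'a::semigroup_mult \<Rightarrow> 'a set" where
  "maximal_subgroup e = \<Union>{G. group (sub_structure G e)}"

definition maximal_subgroups_union :: "'a::semigroup_mult set" where
  "maximal_subgroups_union = (\<Union>e\<in>idempotents. maximal_subgroup e)"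

text \<open>The identity \<open>e\<close> is unique by \<open>maximal_subgroup_unique\<close>; the values of the next two functions
  outside \<open>maximal_subgroups_union\<close> are irrelevant.\<close>

definition inversion :: "'a::semigroup_mult \<Rightarrow> 'a" where
  "inversion x = (let e = (THE e. e \<in> idempotents \<and> x \<in> maximal_subgroup e)
     in m_inv (sub_structure (maximal_subgroup e) e) x)"

definition projection :: "'a::semigroup_mult \<Rightarrow> 'a" where
  "projection x = x * inversion x"

definition sequentially_closed :: "'a::topological_space set \<Rightarrow> bool" where
  "sequentially_closed F \<longleftrightarrow> \<not> (\<exists>x l. (\<forall>n. x n \<in> F) \<and> x \<longlonglongrightarrow> l \<and> l \<notin> F)"

definition sequentially_continuous_map :: "'a topology \<Rightarrow> 'b topology \<Rightarrow> ('a \<Rightarrow> 'b) \<Rightarrow> bool" where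
  "sequentially_continuous_map X Y f \<longleftrightarrow>
     f \<in> topspace X \<rightarrow> topspace Y \<and>
     (\<forall>x l. (\<forall>n. x n \<in> topspace X) \<and> limitin X x l sequentially
        \<longrightarrow> limitin Y (\<lambda>n. f (x n)) (f l) sequentially)"

lemma sub_structure_simps [simp]:
  "carrier (sub_structure G e) = G"
  "monoid.mult (sub_structure G e) = (*)"
  "one (sub_structure G e) = e"
  by (simp_all add: sub_structure_def)

lemma subgroup_identity_idempotent:
  assumes "group (sub_structure G e)"
  shows "e \<in> idempotents"
proof -
  interpret group "sub_structure G e" by (rule assms)
  show ?thesis using l_one[OF one_closed] by (simp add: idempotents_def)
qed

lemma group_invertible_elements:
  assumes e: "e \<in> idempotents"
  shows "group (sub_structure
    {x. e * x = x \<and> x * e = x \<and> (\<exists>y. e * y = y \<and> y * e = y \<and> x * y = e \<and> y * x = e)} e)"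
    (is "group (sub_structure {x. ?P x} e)")
proof (rule groupI, simp_all)
  fix a b :: 'a
  assume a: "?P a" and b: "?P b"
  then obtain c d where c: "e * c = c" "c * e = c" "a * c = e" "c * a = e"
    and d: "e * d = d" "d * e = d" "b * d = e" "d * b = e" by auto
  have "e * (a * b) = a * b" "a * b * e = a * b" "e * (d * c) = d * c" "d * c * e = d * c"
    using a b c d by (metis mult.assoc)+
  moreover have "a * b * (d * c) = e" "d * c * (a * b) = e"
    using a b c d by (metis mult.assoc)+
  ultimately show "e * (a * b) = a * b \<and> a * b * e = a * b \<and>
    (\<exists>y. e * y = y \<and> y * e = y \<and> a * b * y = e \<and> y * (a * b) = e)" by blast
next
  show "e * e = e \<and> (\<exists>y. e * y = y \<and> y * e = y \<and> e * y = e \<and> y * e = e)"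
    using e unfolding idempotents_def by blast
next
  fix a :: 'a
  assume "?P a"
  then show "\<exists>y. e * y = y \<and> y * e = y \<and>
    (\<exists>z. e * z = z \<and> z * e = z \<and> y * z = e \<and> z * y = e) \<and> y * a = e" by blast
qed (auto simp: mult.assoc)

lemma maximal_subgroup_eq:
  assumes e: "e \<in> idempotents"
  shows "maximal_subgroup e =
    {x. e * x = x \<and> x * e = x \<and> (\<exists>y. e * y = y \<and> y * e = y \<and> x * y = e \<and> y * x = e)}"
    (is "_ = {x. ?P x}")
proof (intro equalityI subsetI CollectI)
  fix x
  assume "x \<in> maximal_subgroup e"
  then obtain G where G: "group (sub_structure G e)" and x: "x \<in> G"
    by (auto simp: maximal_subgroup_def)
  interpret group "sub_structure G e" by (rule G)
  have "m_inv (sub_structure G e) x \<in> G" using inv_closed[of x] x by simp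
  with x l_one r_one l_inv[of x] r_inv[of x] show "?P x" by auto
next
  fix x
  assume "x \<in> {x. ?P x}"
  with group_invertible_elements[OF e] show "x \<in> maximal_subgroup e"
    unfolding maximal_subgroup_def by blast
qed

lemma group_maximal_subgroup:
  assumes "e \<in> idempotents"
  shows "group (sub_structure (maximal_subgroup e) e)"
  using group_invertible_elements[OF assms] by (simp only: maximal_subgroup_eq[OF assms])

lemma maximal_subgroup_greatest:
  assumes "group (sub_structure G e)"
  shows "G \<subseteq> maximal_subgroup e"
  using assms unfolding maximal_subgroup_def by blast

lemma maximal_subgroup_unique:
  assumes e: "e \<in> idempotents" and f: "f \<in> idempotents"
    and "x \<in> maximal_subgroup e" "x \<in> maximal_subgroup f"
  shows "e = f"
proof -
  obtain y z where "e * x = x" "x * e = x" "x * y = e" "y * x = e"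
    and "f * x = x" "x * f = x" "x * z = f" "z * x = f"
    using assms(3,4) unfolding maximal_subgroup_eq[OF e] maximal_subgroup_eq[OF f] by auto
  then show ?thesis by (metis mult.assoc)
qed

lemma inversion_eq:
  assumes "e \<in> idempotents" and "x \<in> maximal_subgroup e"
  shows "inversion x = m_inv (sub_structure (maximal_subgroup e) e) x"
proof -
  have "(THE e. e \<in> idempotents \<and> x \<in> maximal_subgroup e) = e"
    using assms maximal_subgroup_unique by blast
  then show ?thesis by (simp add: inversion_def)
qed

end

theory Submission
  imports Defs
begin

text \<open>An element \<open>x\<close> lies in a maximal subgroup iff some \<open>y\<close> satisfies the equations
  \<open>x y = y x\<close>, \<open>x y x = x\<close>, \<open>y x y = y\<close>, and then \<open>y\<close> is its inverse. These equations survive limits.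
  Products of countably compact spaces need not be countably compact, but if \<open>x\<^sub>n \<longlonglongrightarrow> x\<close>, any
  cluster point \<open>y\<close> of the inverses \<open>y\<^sub>n\<close> yields a cluster point \<open>(x, y)\<close> of the pairs, so that
  \<open>y\<close> is the inverse of \<open>x\<close>. Since the cluster point is unique, for subsequences as well,
  \<open>y\<^sub>n\<close> converges to it.\<close>

definition commuting_inverses :: "'a::semigroup_mult \<Rightarrow> 'a \<Rightarrow> bool" where
  "commuting_inverses x y \<longleftrightarrow> x * y = y * x \<and> x * y * x = x \<and> y * x * y = y"

lemma maximal_subgroup_inversion:
  assumes e: "e \<in> idempotents" and x: "x \<in> maximal_subgroup e"
  shows "commuting_inverses x (inversion x)" and "projection x = e"
proof -
  interpret group "sub_structure (maximal_subgroup e) e"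
    by (rule group_maximal_subgroup[OF e])
  have "x * inversion x = e" "inversion x * x = e"
    and "e * x = x" "e * inversion x = inversion x"
    using l_inv[of x] r_inv[of x] l_one[of x] l_one[OF inv_closed[of x]] x
    by (simp_all add: inversion_eq[OF e x])
  then show "commuting_inverses x (inversion x)" "projection x = e"
    by (simp_all add: commuting_inverses_def projection_def)
qed

text \<open>The product \<open>x * y\<close> is the identity to use: by commutation it fixes both
  \<open>x\<close> and \<open>y\<close> from either side, and \<open>x y x = x\<close> makes it
  idempotent.\<close>

lemma commuting_inverses_maximal_subgroup:
  assumes "commuting_inverses x y"
  shows "x * y \<in> idempotents" and "x \<in> maximal_subgroup (x * y)"
proof -
  have xy: "x * y = y * x" "x * y * x = x" "y * x * y = y"
    using assms unfolding commuting_inverses_def by blast+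
  show e: "x * y \<in> idempotents"
    unfolding idempotents_def using xy(2) by (simp flip: mult.assoc)
  have "x * (x * y) = x"
    unfolding xy(1) using xy(2) by (simp only: mult.assoc)
  moreover have "x * y * y = y"
    unfolding xy(1) by (rule xy(3))
  moreover have "y * (x * y) = y"
    using xy(3) by (simp only: mult.assoc)
  moreover note xy(2) xy(1)[symmetric]
  ultimately show "x \<in> maximal_subgroup (x * y)"
    unfolding maximal_subgroup_eq[OF e] by blast
qed

text \<open>Removes the identity \<open>e\<close> from the description of the union: along a
  sequence it may vary, and its convergence is not known in advance.\<close>

lemma maximal_subgroups_union_iff:
  "x \<in> maximal_subgroups_union \<longleftrightarrow> (\<exists>y. commuting_inverses x y)"
proof
  assume "x \<in> maximal_subgroups_union"
  then show "\<exists>y. commuting_inverses x y"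
    by (auto simp: maximal_subgroups_union_def dest: maximal_subgroup_inversion(1))
next
  assume "\<exists>y. commuting_inverses x y"
  then obtain y where "commuting_inverses x y" ..
  from commuting_inverses_maximal_subgroup[OF this] show "x \<in> maximal_subgroups_union"
    unfolding maximal_subgroups_union_def by (rule UN_I)
qed

text \<open>Since \<open>x\<close> lies in \<open>maximal_subgroup (x * y)\<close>, its projection
  is \<open>x * y\<close>. So \<open>y\<close> and \<open>inversion x\<close> have the same product
  with \<open>x\<close>, and commutation lets one be exchanged for the other.\<close>

lemma commuting_inverses_unique:
  assumes "commuting_inverses x y"
  shows "inversion x = y"
proof -
  let ?z = "inversion x"
  note x = commuting_inverses_maximal_subgroup[OF assms]
  have y: "x * y = y * x" "y * x * y = y"
    using assms unfolding commuting_inverses_def by blast+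
  have z: "x * ?z = ?z * x" "?z * x * ?z = ?z"
    using maximal_subgroup_inversion(1)[OF x] unfolding commuting_inverses_def by blast+
  have xz: "x * ?z = x * y"
    using maximal_subgroup_inversion(2)[OF x] unfolding projection_def .
  have "?z = ?z * (x * ?z)" using z(2) by (simp add: mult.assoc)
  also have "\<dots> = ?z * x * y" unfolding xz by (simp add: mult.assoc)
  also have "\<dots> = x * y * y" unfolding z(1)[symmetric] xz ..
  also have "\<dots> = y" unfolding y ..
  finally show ?thesis .
qed

lemma commuting_inverses_inversion:
  "x \<in> maximal_subgroups_union \<Longrightarrow> commuting_inverses x (inversion x)"
  by (auto simp: maximal_subgroups_union_def dest: maximal_subgroup_inversion(1))

lemma commuting_inverses_sym: "commuting_inverses x y \<Longrightarrow> commuting_inverses y x"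
  unfolding commuting_inverses_def by metis

text \<open>Both sides of each equation converge by continuity of the product, and limits are unique
  in a Hausdorff space. An arbitrary filter is allowed because cluster points are reached along
  filters rather than subsequences.\<close>

lemma tendsto_commuting_inverses:
  fixes x y :: "'i \<Rightarrow> 'a::{topological_semigroup_mult, t2_space}"
  assumes "F \<noteq> bot" and x: "(x \<longlongrightarrow> a) F" and y: "(y \<longlongrightarrow> b) F"
    and xy: "\<And>i. commuting_inverses (x i) (y i)"
  shows "commuting_inverses a b"
proof -
  have "x i * y i = y i * x i" "x i * y i * x i = x i" "y i * x i * y i = y i" for i
    using xy[of i] unfolding commuting_inverses_def by blast+
  moreover have "((\<lambda>i. x i * y i) \<longlongrightarrow> a * b) F" "((\<lambda>i. y i * x i) \<longlongrightarrow> b * a) F"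
    "((\<lambda>i. x i * y i * x i) \<longlongrightarrow> a * b * a) F" "((\<lambda>i. y i * x i * y i) \<longlongrightarrow> b * a * b) F"
    by (intro tendsto_mult x y)+
  ultimately show ?thesis
    unfolding commuting_inverses_def using tendsto_unique[OF \<open>F \<noteq> bot\<close>] x y by auto
qed

text \<open>Without first countability a cluster point need not be the limit of a subsequence, so it
  is expressed as a limit along a proper filter finer than \<open>sequentially\<close>.\<close>

lemma countably_compact_cluster_point:
  fixes y :: "nat \<Rightarrow> 'a::topological_space"
  assumes "countably_compact (UNIV :: 'a set)"
  obtains l F where "F \<noteq> bot" "F \<le> sequentially" "(y \<longlongrightarrow> l) F"
proof -
  have "\<exists>l. \<forall>n. l \<in> closure (y ` {n..})"
  proof (rule ccontr)
    assume *: "\<nexists>l. \<forall>n. l \<in> closure (y ` {n..})"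
    \<comment> \<open>Without a common point of the tail closures, their complements form a
      countable open cover. For a finite subcover indexed by \<open>N\<close>, the point
      \<open>y (Max N)\<close> lies in every tail starting at an index in \<open>N\<close>, so it is
      not covered.\<close>
    let ?C = "\<lambda>n. - closure (y ` {n..})"
    have cover: "UNIV \<subseteq> \<Union> (range ?C)" using * by auto
    obtain T where T: "T \<subseteq> range ?C" "finite T" "UNIV \<subseteq> \<Union>T"
      by (rule countably_compactE[OF assms _ cover]) auto
    obtain N where N: "finite N" "T = ?C ` N"
      using finite_subset_image[OF T(2,1)] by auto
    obtain n where n: "n \<in> N" "y (Max N) \<in> ?C n"
      using T(3) N(2) by blast
    then have "y (Max N) \<in> y ` {n..}" using N(1) by auto
    then have "y (Max N) \<in> closure (y ` {n..})" by (rule subsetD[OF closure_subset])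
    with n(2) show False by simp
  qed
  then obtain l where l: "l \<in> closure (y ` {n..})" for n by blast
  \<comment> \<open>The coarsest filter that refines \<open>sequentially\<close> and sends
    \<open>y\<close> to \<open>l\<close>. It is proper because every neighbourhood of
    \<open>l\<close> meets every tail of \<open>y\<close>.\<close>
  define F where "F = inf sequentially (filtercomap y (nhds l))"
  have "F \<noteq> bot"
    unfolding F_def trivial_limit_def
  proof
    assume "\<forall>\<^sub>F n in inf sequentially (filtercomap y (nhds l)). False"
    then obtain P Q where "eventually P sequentially" "eventually Q (filtercomap y (nhds l))"
      and PQ: "\<And>n. P n \<Longrightarrow> Q n \<Longrightarrow> False"
      by (auto simp: eventually_inf)
    then obtain N U where N: "\<And>n. n \<ge> N \<Longrightarrow> P n"
      and U: "open U" "l \<in> U" "\<And>n. y n \<in> U \<Longrightarrow> Q n"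
      unfolding eventually_sequentially eventually_filtercomap_nhds by blast
    obtain n where "n \<ge> N" "y n \<in> U"
      using l[of N] open_Int_closure_eq_empty[OF U(1), of "y ` {N..}"] U(2) by auto
    then show False using N U(3) PQ by blast
  qed
  moreover have "F \<le> sequentially" "(y \<longlongrightarrow> l) F"
    by (simp_all add: F_def filterlim_iff_le_filtercomap)
  ultimately show thesis using that by blast
qed

context
  assumes cc: "countably_compact (UNIV :: 'a::{topological_semigroup_mult, t2_space} set)"
begin

lemma inverse_sequence_cluster_point:
  fixes x y :: "nat \<Rightarrow> 'a"
  assumes x: "x \<longlonglongrightarrow> a" and xy: "\<And>n. commuting_inverses (x n) (y n)"
  obtains F where "F \<noteq> bot" "F \<le> sequentially" "(y \<longlongrightarrow> inversion a) F"
    "a \<in> maximal_subgroups_union"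
proof -
  obtain b F where F: "F \<noteq> bot" "F \<le> sequentially" "(y \<longlongrightarrow> b) F"
    by (rule countably_compact_cluster_point[OF cc])
  \<comment> \<open>As \<open>F\<close> refines \<open>sequentially\<close>, \<open>x\<close> still
    tends to \<open>a\<close> along \<open>F\<close>, so both sequences converge along the same
    filter.\<close>
  have "commuting_inverses a b"
    using tendsto_commuting_inverses[OF F(1) tendsto_mono[OF F(2) x] F(3) xy] .
  then have "inversion a = b" "a \<in> maximal_subgroups_union"
    by (rule commuting_inverses_unique)
      (use \<open>commuting_inverses a b\<close> maximal_subgroups_union_iff in blast)
  with F that show thesis by simp
qed

lemma tendsto_inversion:
  fixes x :: "nat \<Rightarrow> 'a"
  assumes mem: "\<And>n. x n \<in> maximal_subgroups_union" and x: "x \<longlonglongrightarrow> a"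
  shows "a \<in> maximal_subgroups_union" and "(\<lambda>n. inversion (x n)) \<longlonglongrightarrow> inversion a"
proof -
  have inv: "commuting_inverses (x n) (inversion (x n))" for n
    using mem by (rule commuting_inverses_inversion)
  show "a \<in> maximal_subgroups_union"
    using inverse_sequence_cluster_point[OF x inv] by blast
  show "(\<lambda>n. inversion (x n)) \<longlonglongrightarrow> inversion a"
  proof (rule topological_tendstoI, rule ccontr)
    fix U
    assume U: "open U" "inversion a \<in> U"
      and "\<not> (\<forall>\<^sub>F n in sequentially. inversion (x n) \<in> U)"
    \<comment> \<open>The bad indices form a subsequence on which \<open>x\<close> still tends to
      \<open>a\<close>. Its inverses cluster at \<open>inversion a\<close>, so some of them enter
      \<open>U\<close>, contrary to the choice of indices.\<close>
    then have inf: "infinite {n. inversion (x n) \<notin> U}"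
      by (simp add: not_eventually frequently_cofinite flip: cofinite_eq_sequentially)
    define r where "r = enumerate {n. inversion (x n) \<notin> U}"
    have r: "strict_mono r" "\<And>n. inversion (x (r n)) \<notin> U"
      using strict_mono_enumerate[OF inf] enumerate_in_set[OF inf] by (auto simp: r_def)
    have xr: "(\<lambda>n. x (r n)) \<longlonglongrightarrow> a"
      using LIMSEQ_subseq_LIMSEQ[OF x r(1)] by (simp add: o_def)
    obtain F where F: "F \<noteq> bot" "((\<lambda>n. inversion (x (r n))) \<longlongrightarrow> inversion a) F"
      by (rule inverse_sequence_cluster_point[OF xr inv])
    have "\<forall>\<^sub>F n in F. inversion (x (r n)) \<in> U"
      using topological_tendstoD[OF F(2) U] .
    with r(2) F(1) show False by (simp add: trivial_limit_def)
  qed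
qed

lemma tendsto_projection:
  fixes x :: "nat \<Rightarrow> 'a"
  assumes "\<And>n. x n \<in> maximal_subgroups_union" and "x \<longlonglongrightarrow> a"
  shows "(\<lambda>n. projection (x n)) \<longlonglongrightarrow> projection a"
  unfolding projection_def
  by (rule tendsto_mult[OF assms(2) tendsto_inversion(2)[OF assms]])

text \<open>The projection is constantly \<open>e\<close> along the sequence, hence also at the
  limit. The limit lies in some \<open>maximal_subgroup f\<close>, where the projection is
  \<open>f\<close>, so \<open>f = e\<close>.\<close>

lemma sequentially_closed_maximal_subgroup:
  assumes e: "e \<in> (idempotents :: 'a set)"
  shows "sequentially_closed (maximal_subgroup e)"
  unfolding sequentially_closed_def
proof clarify
  fix x :: "nat \<Rightarrow> 'a" and a
  assume mem: "\<forall>n. x n \<in> maximal_subgroup e" and x: "x \<longlonglongrightarrow> a" and "a \<notin> maximal_subgroup e"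
  have mem': "x n \<in> maximal_subgroups_union" for n
    using mem e by (auto simp: maximal_subgroups_union_def)
  have "(\<lambda>n. e) \<longlonglongrightarrow> projection a"
    using tendsto_projection[OF mem' x] maximal_subgroup_inversion(2)[OF e] mem by simp
  then have "projection a = e" by (simp add: LIMSEQ_const_iff)
  moreover obtain f where f: "f \<in> idempotents" "a \<in> maximal_subgroup f"
    using tendsto_inversion(1)[OF mem' x] by (auto simp: maximal_subgroups_union_def)
  ultimately show False
    using \<open>a \<notin> maximal_subgroup e\<close> maximal_subgroup_inversion(2)[OF f] by simp
qed

end

theorem theorem10:
  assumes "countably_compact (UNIV :: 'a::{topological_semigroup_mult, t2_space} set)"
  shows "(\<forall>e \<in> (idempotents :: 'a set). sequentially_closed (maximal_subgroup e)) \<and>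
    sequentially_closed (maximal_subgroups_union :: 'a set) \<and>
    sequentially_continuous_map (top_of_set (maximal_subgroups_union :: 'a set))
           (top_of_set maximal_subgroups_union) inversion \<and>
    sequentially_continuous_map (top_of_set (maximal_subgroups_union :: 'a set))
           (top_of_set idempotents) projection"
proof -
  note lim = tendsto_inversion[OF assms] tendsto_projection[OF assms]
  \<comment> \<open>Convergence in a subspace is convergence in the whole space together with
    membership of the limit and, eventually, of the terms. These facts supply the
    memberships.\<close>
  have inv_mem: "inversion x \<in> maximal_subgroups_union"
    and proj_mem: "projection x \<in> idempotents"
    if "x \<in> maximal_subgroups_union" for x :: 'a
  proof -
    have inv: "commuting_inverses x (inversion x)"
      by (rule commuting_inverses_inversion[OF that])
    show "inversion x \<in> maximal_subgroups_union"
      unfolding maximal_subgroups_union_iff by (rule exI, rule commuting_inverses_sym[OF inv])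
    show "projection x \<in> idempotents"
      unfolding projection_def by (rule commuting_inverses_maximal_subgroup(1)[OF inv])
  qed
  have "sequentially_closed (maximal_subgroups_union :: 'a set)"
    unfolding sequentially_closed_def
  proof clarify
    fix x :: "nat \<Rightarrow> 'a" and a
    assume "\<forall>n. x n \<in> maximal_subgroups_union" "x \<longlonglongrightarrow> a" "a \<notin> maximal_subgroups_union"
    then show False using lim(1)[of x a] by simp
  qed
  moreover have "sequentially_continuous_map (top_of_set (maximal_subgroups_union :: 'a set))
      (top_of_set maximal_subgroups_union) inversion"
    unfolding sequentially_continuous_map_def
    by (simp add: limitin_subtopology inv_mem lim(2))
  moreover have "sequentially_continuous_map (top_of_set (maximal_subgroups_union :: 'a set))
      (top_of_set idempotents) projection"
    unfolding sequentially_continuous_map_def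
    by (simp add: limitin_subtopology proj_mem lim(3))
  ultimately show ?thesis
    using sequentially_closed_maximal_subgroup[OF assms] by simp
qed

end
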